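(* The minimum transmission-energy function $E_{\rm off}(\ell)$ is a convex function of $\ell$.
   Context: The helper's CPU timeline is divided into epochs $k=1,\dots,K$ of lengths $\tau_k>0$, with $a_k\in\{0,1\}$ indicating whether the CPU is idle ($1$) or busy ($0$) in epoch $k$; consecutive epochs have different states and epoch $K$ is idle. With helper CPU frequency $f_h>0$ and $C>0$ cycles per bit, the CPU-idling profile is $U_k=\sum_{j=1}^ka_j\tau_jf_h/C$. For a total offloaded data size $0\le\ell\le U_K$, let $$\bar{\mathcal T}(\ell)=\Big\{\boldsymbol{\ell}=(\ell_1,\dots,\ell_K)\ :\ [U_k-\Delta(\ell)]^+\le\sum_{j=1}^k\ell_j\le\ell,\ k=1,\dots,K-1,\ \sum_{k=1}^K\ell_k=\ell\Big\},$$ with $\Delta(\ell)=U_K-\ell$ and $[x]^+=\max\{x,0\}$ (the effective offloading feasibility tunnel). The minimum transmission energy for offloading $\ell$ bits is $$E_{\rm off}(\ell)=\min_{\boldsymbol{\ell}\ge\boldsymbol 0,\ \boldsymbol{\ell}\in\bar{\mathcal T}(\ell)}\ \sum_{k=1}^K\frac{\tau_k}{h^2}\,g\!\left(\frac{\ell_k}{\tau_k}\right),\qquad g(x)=N_0(2^{x/W}-1),$$ where $h,N_0,W>0$ are constants. $E_{\rm off}$ is considered on $[0,U_K]$. *)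

theory Defs
  imports "HOL-Analysis.Analysis"
begin

text \<open>
  Epochs are indexed by \<open>{1..K}\<close>. A vector in \<open>\<real>\<^sup>K\<close> is a function in the extensional function
  space \<open>{1..K} \<rightarrow>\<^sub>E UNIV\<close>, so that values outside \<open>{1..K}\<close> carry no information.
\<close>

definition idling_profile ::
    "(nat \<Rightarrow> nat) \<Rightarrow> (nat \<Rightarrow> real) \<Rightarrow> real \<Rightarrow> real \<Rightarrow> nat \<Rightarrow> real" where
  "idling_profile a \<tau> fh C k = (\<Sum>j=1..k. real (a j) * \<tau> j * fh / C)"

text \<open>
  The tunnel for a nondecreasing profile \<open>U\<close> (only \<open>U 1, \<dots>, U K\<close> are used). Nonnegativity of the
  components is not part of the tunnel; it is a separate constraint of the minimization.
\<close>

definition effective_tunnel :: "nat \<Rightarrow> (nat \<Rightarrow> real) \<Rightarrow> real \<Rightarrow> (nat \<Rightarrow> real) set" where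
  "effective_tunnel K U l =
    {x \<in> {1..K} \<rightarrow>\<^sub>E UNIV.
       (\<forall>k\<in>{1..K-1}. max (U k - (U K - l)) 0 \<le> (\<Sum>j=1..k. x j) \<and> (\<Sum>j=1..k. x j) \<le> l) \<and>
       (\<Sum>k=1..K. x k) = l}"

definition power_fun :: "real \<Rightarrow> real \<Rightarrow> real \<Rightarrow> real" where
  "power_fun N0 W x = N0 * (2 powr (x / W) - 1)"

definition transmission_energy ::
    "nat \<Rightarrow> (nat \<Rightarrow> real) \<Rightarrow> real \<Rightarrow> real \<Rightarrow> real \<Rightarrow> (nat \<Rightarrow> real) \<Rightarrow> real" where
  "transmission_energy K \<tau> h N0 W x = (\<Sum>k=1..K. \<tau> k / h\<^sup>2 * power_fun N0 W (x k / \<tau> k))"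

text \<open>
  \<open>LEAST\<close> denotes a genuine minimum: it is determined only if the least value is attained
  (unlike \<open>Inf\<close>). This is the case for \<open>0 \<le> l \<le> U\<^sub>K\<close>, where the feasible set is nonempty and
  compact.
\<close>

definition E_off ::
    "nat \<Rightarrow> (nat \<Rightarrow> nat) \<Rightarrow> (nat \<Rightarrow> real) \<Rightarrow> real \<Rightarrow> real \<Rightarrow> real \<Rightarrow> real \<Rightarrow> real \<Rightarrow> real \<Rightarrow> real" where
  "E_off K a \<tau> fh C h N0 W l =
    (LEAST e. \<exists>x \<in> effective_tunnel K (idling_profile a \<tau> fh C) l.
       (\<forall>k\<in>{1..K}. 0 \<le> x k) \<and> e = transmission_energy K \<tau> h N0 W x)"

end

theory Submission
  imports Defs
begin

text \<open>
  The minimand is jointly convex in the offloading vector, and the constraints are jointly convex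
  in the vector and the total size \<open>l\<close>. Hence the convex combination of minimizers for two sizes is
  feasible for the combined size, at no more than the combined energy. Minimizers exist because
  the feasible set is nonempty (offload everything in the first epoch) and compact.
\<close>

text \<open>The domain of the minimization in \<open>E_off\<close>, but for an arbitrary profile
  \<open>U\<close>; the CPU model enters later, through monotonicity of the profile.\<close>

definition feasible_set :: "nat \<Rightarrow> (nat \<Rightarrow> real) \<Rightarrow> real \<Rightarrow> (nat \<Rightarrow> real) set" where
  "feasible_set K U l = {x \<in> effective_tunnel K U l. \<forall>k\<in>{1..K}. 0 \<le> x k}"

text \<open>Tychonoff's theorem, transferred to the function type, whose topology is the product
  topology over the whole index type.\<close>

lemma compact_PiE_UNIV:
  fixes S :: "'a \<Rightarrow> 'b::topological_space set"
  assumes "\<And>i. compact (S i)"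
  shows "compact (PiE UNIV S)"
  using compactin_PiE[of "\<lambda>_. euclidean" UNIV S] assms
  by (simp add: euclidean_product_topology)

lemma continuous_on_coordinate:
  fixes S :: "('a \<Rightarrow> 'b::topological_space) set"
  shows "continuous_on S (\<lambda>x. x i)"
  by (rule continuous_on_subset[OF continuous_on_product_coordinates]) simp

lemma compact_feasible_set: "compact (feasible_set K U l)"
proof -
  \<comment> \<open>Nonnegativity and total \<open>l\<close> confine each epoch's share to
    \<open>{0..l}\<close>. Extensionality becomes a singleton factor outside \<open>{1..K}\<close>,
    so that the box has a compact factor at every index.\<close>
  define B where "B k = (if k \<in> {1..K} then {0..l} else {undefined})" for k
  define F where "F = {x :: nat \<Rightarrow> real.
    (\<forall>k\<in>{1..K-1}. max (U k - (U K - l)) 0 \<le> (\<Sum>j=1..k. x j) \<and> (\<Sum>j=1..k. x j) \<le> l) \<and>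
    (\<Sum>k=1..K. x k) = l}"
  have "closed F"
    \<comment> \<open>With the bounded quantifier unfolded, membership of \<open>k\<close> is a
      premise independent of \<open>x\<close>, hence an open condition as
      \<open>closed_Collect_imp\<close> demands.\<close>
    unfolding F_def Ball_def
    by (intro closed_Collect_conj closed_Collect_all closed_Collect_imp closed_Collect_le
        closed_Collect_eq open_Collect_const continuous_on_sum continuous_on_coordinate
        continuous_on_const)
  moreover have "compact (PiE UNIV B)"
    by (rule compact_PiE_UNIV) (simp add: B_def)
  moreover have "feasible_set K U l = PiE UNIV B \<inter> F"
  proof (intro set_eqI iffI)
    fix x assume x: "x \<in> feasible_set K U l"
    have "x k \<in> B k" for k
    proof (cases "k \<in> {1..K}")
      case True
      then have "x k \<le> (\<Sum>j=1..K. x j)"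
        using x by (intro member_le_sum) (auto simp: feasible_set_def)
      then show ?thesis
        using x True by (auto simp: feasible_set_def effective_tunnel_def B_def)
    next
      case False
      then show ?thesis
        using x by (auto simp: feasible_set_def effective_tunnel_def B_def PiE_def extensional_def)
    qed
    then show "x \<in> PiE UNIV B \<inter> F"
      using x by (auto simp: feasible_set_def effective_tunnel_def F_def)
  next
    fix x assume x: "x \<in> PiE UNIV B \<inter> F"
    then have B: "x k \<in> B k" for k
      by auto
    have "x k = undefined" if "k \<notin> {1..K}" for k
      using B[of k] that unfolding B_def by (simp only: if_False singleton_iff)
    then have "x \<in> {1..K} \<rightarrow>\<^sub>E UNIV"
      by (simp add: PiE_def extensional_def)
    moreover have "0 \<le> x k" if "k \<in> {1..K}" for k
      using B[of k] that by (simp add: B_def)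
    ultimately show "x \<in> feasible_set K U l"
      using x by (simp add: feasible_set_def effective_tunnel_def F_def)
  qed
  ultimately show ?thesis
    by (simp add: compact_Int_closed)
qed

text \<open>With everything sent in epoch 1, each partial sum equals its upper bound
  \<open>l\<close>; the lower bound stays below \<open>l\<close> because
  \<open>U k \<le> U K\<close>.\<close>

lemma feasible_set_nonempty:
  assumes "1 \<le> K" "0 \<le> l" and U: "\<And>k. k \<in> {1..K} \<Longrightarrow> U k \<le> U K"
  shows "feasible_set K U l \<noteq> {}"
proof -
  define x where "x = (\<lambda>k\<in>{1..K}. if k = 1 then l else 0)"
  have sum: "(\<Sum>j=1..k. x j) = l" if "k \<in> {1..K}" for k
  proof -
    have "(\<Sum>j=1..k. x j) = (\<Sum>j=1..k. if j = 1 then l else 0)"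
      using that by (intro sum.cong) (auto simp: x_def)
    also have "\<dots> = l"
      using that by simp
    finally show ?thesis .
  qed
  have "max (U k - (U K - l)) 0 \<le> (\<Sum>j=1..k. x j) \<and> (\<Sum>j=1..k. x j) \<le> l"
    if "k \<in> {1..K-1}" for k
  proof -
    have "k \<in> {1..K}"
      using that by auto
    then show ?thesis
      using sum[of k] U[of k] \<open>0 \<le> l\<close> by simp
  qed
  moreover have "(\<Sum>k=1..K. x k) = l"
    using \<open>1 \<le> K\<close> by (intro sum) simp
  moreover have "x \<in> {1..K} \<rightarrow>\<^sub>E UNIV" "\<forall>k\<in>{1..K}. 0 \<le> x k"
    using \<open>0 \<le> l\<close> by (auto simp: x_def)
  ultimately have "x \<in> feasible_set K U l"
    unfolding feasible_set_def effective_tunnel_def by blast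
  then show ?thesis
    by blast
qed

text \<open>Each lower bound is the maximum of 0 and an affine function of the total size, and the
  remaining bounds are affine in it, so weighted averages preserve all constraints.\<close>

lemma convex_combination_feasible:
  assumes x: "x \<in> feasible_set K U l" and y: "y \<in> feasible_set K U m"
    and uv: "0 \<le> u" "0 \<le> v" "u + v = 1"
  shows "(\<lambda>k\<in>{1..K}. u * x k + v * y k) \<in> feasible_set K U (u * l + v * m)" (is "?z \<in> _")
proof -
  have sum: "(\<Sum>j=1..k. ?z j) = u * (\<Sum>j=1..k. x j) + v * (\<Sum>j=1..k. y j)" if "k \<le> K" for k
  proof -
    have "(\<Sum>j=1..k. ?z j) = (\<Sum>j=1..k. u * x j + v * y j)"
      using that by (intro sum.cong) auto
    then show ?thesis
      by (simp add: sum.distrib sum_distrib_left)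
  qed
  have "max (U k - (U K - (u * l + v * m))) 0 \<le> (\<Sum>j=1..k. ?z j) \<and>
      (\<Sum>j=1..k. ?z j) \<le> u * l + v * m" if k: "k \<in> {1..K-1}" for k
  proof -
    define X Y D where "X = (\<Sum>j=1..k. x j)" and "Y = (\<Sum>j=1..k. y j)" and "D = U k - U K"
    have "max (U k - (U K - l)) 0 \<le> X \<and> X \<le> l" "max (U k - (U K - m)) 0 \<le> Y \<and> Y \<le> m"
      using x y k unfolding feasible_set_def effective_tunnel_def X_def Y_def by blast+
    then have X: "D + l \<le> X" "0 \<le> X" "X \<le> l" and Y: "D + m \<le> Y" "0 \<le> Y" "Y \<le> m"
      unfolding D_def by linarith+
    have "u * (D + l) + v * (D + m) \<le> u * X + v * Y"
      using X Y uv by (intro add_mono mult_left_mono)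
    \<comment> \<open>The weights sum to 1, so the offset \<open>D\<close> common to both lower
      bounds survives averaging unchanged.\<close>
    moreover have "u * (D + l) + v * (D + m) = D + (u * l + v * m)"
      using uv(3) by algebra
    moreover have "0 \<le> u * X + v * Y"
      using X Y uv by simp
    moreover have "u * X + v * Y \<le> u * l + v * m"
      using X Y uv by (intro add_mono mult_left_mono)
    moreover have "(\<Sum>j=1..k. ?z j) = u * X + v * Y"
      unfolding X_def Y_def using k by (intro sum) auto
    ultimately show ?thesis
      by (simp add: D_def)
  qed
  moreover have "(\<Sum>k=1..K. ?z k) = u * l + v * m"
    using sum[of K] x y by (simp add: feasible_set_def effective_tunnel_def)
  moreover have "\<forall>k\<in>{1..K}. 0 \<le> ?z k"
    using x y uv by (simp add: feasible_set_def)
  ultimately show ?thesis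
    by (simp add: feasible_set_def effective_tunnel_def)
qed

text \<open>Written with base e, the function has second derivative
  \<open>N0 * c\<^sup>2 * exp (c * x)\<close>, which is nonnegative.\<close>

lemma convex_on_power_fun:
  assumes "0 \<le> N0"
  shows "convex_on UNIV (power_fun N0 W)"
proof (intro f''_ge0_imp_convex)
  define c where "c = ln 2 / W"
  have eq: "power_fun N0 W = (\<lambda>x. N0 * (exp (c * x) - 1))"
    by (simp add: fun_eq_iff power_fun_def powr_def c_def mult.commute)
  show "(power_fun N0 W has_real_derivative N0 * c * exp (c * x)) (at x)" for x
    unfolding eq by (auto intro!: derivative_eq_intros)
  show "((\<lambda>x. N0 * c * exp (c * x)) has_real_derivative N0 * c\<^sup>2 * exp (c * x)) (at x)" for x
    by (auto intro!: derivative_eq_intros simp: power2_eq_square)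
qed (use assms in auto)

text \<open>The epoch lengths are fixed, so each summand is a nonnegative multiple of a convex
  function of a linear argument; the inequality holds epoch by epoch.\<close>

lemma transmission_energy_convex_combination:
  assumes \<tau>: "\<And>k. k \<in> {1..K} \<Longrightarrow> 0 < \<tau> k" and "0 \<le> N0"
    and uv: "0 \<le> u" "0 \<le> v" "u + v = 1"
  shows "transmission_energy K \<tau> h N0 W (\<lambda>k\<in>{1..K}. u * x k + v * y k)
    \<le> u * transmission_energy K \<tau> h N0 W x + v * transmission_energy K \<tau> h N0 W y"
proof -
  let ?g = "power_fun N0 W"
  have "transmission_energy K \<tau> h N0 W (\<lambda>k\<in>{1..K}. u * x k + v * y k)
      \<le> (\<Sum>k=1..K. \<tau> k / h\<^sup>2 * (u * ?g (x k / \<tau> k) + v * ?g (y k / \<tau> k)))"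
    unfolding transmission_energy_def
  proof (intro sum_mono mult_left_mono)
    fix k assume k: "k \<in> {1..K}"
    have "?g (u * (x k / \<tau> k) + v * (y k / \<tau> k)) \<le> u * ?g (x k / \<tau> k) + v * ?g (y k / \<tau> k)"
      using convex_on_power_fun[OF \<open>0 \<le> N0\<close>, of W] uv
      unfolding convex_on_def real_scaleR_def by blast
    then show "?g ((\<lambda>k\<in>{1..K}. u * x k + v * y k) k / \<tau> k)
        \<le> u * ?g (x k / \<tau> k) + v * ?g (y k / \<tau> k)"
      using k by (simp add: add_divide_distrib)
    show "0 \<le> \<tau> k / h\<^sup>2"
      using \<tau>[OF k] by simp
  qed
  also have "\<dots> = u * transmission_energy K \<tau> h N0 W x + v * transmission_energy K \<tau> h N0 W y"
    by (simp add: transmission_energy_def sum_distrib_left algebra_simps add_divide_distrib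
        flip: sum.distrib)
  finally show ?thesis .
qed

lemma continuous_on_transmission_energy:
  "continuous_on S (transmission_energy K \<tau> h N0 W)"
  \<comment> \<open>Division becomes multiplication by a constant, which leaves only
    \<open>2 \<noteq> 0\<close> as a side condition, from \<open>powr\<close>.\<close>
  unfolding transmission_energy_def power_fun_def divide_inverse
  by (intro continuous_on_sum continuous_on_mult continuous_on_diff continuous_on_powr
      continuous_on_coordinate continuous_on_const) simp

lemma idling_profile_mono:
  assumes "k \<le> K" "\<And>j. j \<in> {1..K} \<Longrightarrow> 0 \<le> \<tau> j" "0 \<le> fh" "0 \<le> C"
  shows "idling_profile a \<tau> fh C k \<le> idling_profile a \<tau> fh C K"
  unfolding idling_profile_def using assms by (intro sum_mono2) auto

text \<open>Replaces \<open>LEAST\<close> by the energy of an exhibited minimizer.\<close>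

lemma E_off_eq_minimum:
  assumes "x \<in> feasible_set K (idling_profile a \<tau> fh C) l"
    and "\<And>y. y \<in> feasible_set K (idling_profile a \<tau> fh C) l \<Longrightarrow>
      transmission_energy K \<tau> h N0 W x \<le> transmission_energy K \<tau> h N0 W y"
  shows "E_off K a \<tau> fh C h N0 W l = transmission_energy K \<tau> h N0 W x"
  unfolding E_off_def using assms by (intro Least_equality) (auto simp: feasible_set_def)

text \<open>A continuous function on a nonempty compact set attains its infimum. Attainment serves
  at the two given sizes, the lower bound at their combination.\<close>

lemma E_off_attained:
  fixes a :: "nat \<Rightarrow> nat"
  assumes "1 \<le> K" "\<And>k. k \<in> {1..K} \<Longrightarrow> 0 \<le> \<tau> k" "0 \<le> fh" "0 \<le> C" "0 \<le> l"
  obtains x where "x \<in> feasible_set K (idling_profile a \<tau> fh C) l"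
    and "E_off K a \<tau> fh C h N0 W l = transmission_energy K \<tau> h N0 W x"
    and "\<And>y. y \<in> feasible_set K (idling_profile a \<tau> fh C) l \<Longrightarrow>
      E_off K a \<tau> fh C h N0 W l \<le> transmission_energy K \<tau> h N0 W y"
proof -
  let ?F = "feasible_set K (idling_profile a \<tau> fh C) l"
  have "?F \<noteq> {}"
    using assms by (intro feasible_set_nonempty idling_profile_mono) auto
  then obtain x where x: "x \<in> ?F"
      "\<forall>y\<in>?F. transmission_energy K \<tau> h N0 W x \<le> transmission_energy K \<tau> h N0 W y"
    using continuous_attains_inf[OF compact_feasible_set _ continuous_on_transmission_energy]
    by blast
  then show thesis
    using that[of x] E_off_eq_minimum[of x] by auto
qed

theorem lemma2:
  fixes K :: nat and a :: "nat \<Rightarrow> nat" and \<tau> :: "nat \<Rightarrow> real"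
    and fh C h N0 W :: real
  assumes "1 \<le> K"
    and "\<And>k. k \<in> {1..K} \<Longrightarrow> 0 < \<tau> k"
    and "\<And>k. k \<in> {1..K} \<Longrightarrow> a k \<in> {0, 1}"
    and "\<And>k. k \<in> {1..<K} \<Longrightarrow> a k \<noteq> a (Suc k)"
    and "a K = 1"
    and "0 < fh" and "0 < C" and "0 < h" and "0 < N0" and "0 < W"
  shows "convex_on {0..idling_profile a \<tau> fh C K} (E_off K a \<tau> fh C h N0 W)"
  unfolding convex_on_def
proof (intro conjI ballI allI impI)
  let ?F = "feasible_set K (idling_profile a \<tau> fh C)"
  let ?E = "E_off K a \<tau> fh C h N0 W" and ?T = "transmission_energy K \<tau> h N0 W"
  have nonneg: "0 \<le> \<tau> k" if "k \<in> {1..K}" for k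
    using assms(2)[OF that] by simp
  \<comment> \<open>Everything but the size is fixed here, since three sizes are treated
    below.\<close>
  note attained = E_off_attained[where a = a and h = h and ?N0.0 = N0 and W = W and \<tau> = \<tau>,
      OF \<open>1 \<le> K\<close> nonneg less_imp_le[OF \<open>0 < fh\<close>] less_imp_le[OF \<open>0 < C\<close>]]
  fix l m u v :: real
  assume lm: "l \<in> {0..idling_profile a \<tau> fh C K}" "m \<in> {0..idling_profile a \<tau> fh C K}"
    and uv: "0 \<le> u" "0 \<le> v" "u + v = 1"
  obtain x where x: "x \<in> ?F l" "?E l = ?T x"
    using attained[of l] lm by auto
  obtain y where y: "y \<in> ?F m" "?E m = ?T y"
    using attained[of m] lm by auto
  have "0 \<le> u * l + v * m"
    using lm uv by simp
  \<comment> \<open>The averaged minimizers need only be feasible for the combined size, not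
    optimal.\<close>
  then have "?E (u * l + v * m) \<le> ?T (\<lambda>k\<in>{1..K}. u * x k + v * y k)"
    using attained[of "u * l + v * m"] convex_combination_feasible[OF x(1) y(1) uv] by metis
  also have "\<dots> \<le> u * ?T x + v * ?T y"
    using assms(2) \<open>0 < N0\<close> uv by (intro transmission_energy_convex_combination) auto
  finally show "?E (u *\<^sub>R l + v *\<^sub>R m) \<le> u * ?E l + v * ?E m"
    using x y by simp
\<comment> \<open>What remains is convexity of the interval, the other conjunct of
  \<open>convex_on_def\<close>.\<close>
qed simp

end
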